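(* Let $p\in[1,\infty)$, $n\in\mathbb{N}$ with $n\ge 1$, $K\in(0,\infty)$, let $\mu$ be a probability measure and let $x_1,\ldots,x_n\in L_p(\mu)$ be a $K$-incompressible family, i.e. $\big\|\max_{i\in\{1,\ldots,n\}}|x_i|\big\|_{L_p(\mu)}\leq K$. Then for every $\varepsilon\in(0,1)$ there exist a nonnegative integer $d$ with $$d\leq \frac{32e^2(2K)^{2p}\log n}{\varepsilon^2}$$ and points $y_1,\ldots,y_n\in\ell_p^d$ such that $$\forall\, i,j\in\{1,\ldots,n\},\qquad \|x_i-x_j\|_{L_p(\mu)}^p-\varepsilon\leq \|y_i-y_j\|_{\ell_p^d}^p\leq \|x_i-x_j\|_{L_p(\mu)}^p+\varepsilon.$$
   Context: All functions are real-valued. $\ell_p^d$ denotes $\mathbb{R}^d$ equipped with the norm $\|a\|_{\ell_p^d}=\big(\sum_{i=1}^d|a_i|^p\big)^{1/p}$, with the convention $\ell_p^0=\{0\}$. The function $\max_i|x_i|$ is the pointwise ($\mu$-a.e.) maximum of the absolute values. $\log$ is the natural logarithm and $e$ is its base. *)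

theory Defs
  imports "HOL-Probability.Probability"
begin

text \<open>
  Elements of \<open>L\<^sub>p(\<mu>)\<close> are represented by functions rather than by \<open>\<mu>\<close>-a.e. classes; the norm
  below depends only on the class.
\<close>

definition Lp_space :: "real \<Rightarrow> 'a measure \<Rightarrow> ('a \<Rightarrow> real) set" where
  "Lp_space p \<mu> = {f \<in> borel_measurable \<mu>. integrable \<mu> (\<lambda>\<omega>. \<bar>f \<omega>\<bar> powr p)}"

text \<open>Only meaningful on \<^const>\<open>Lp_space\<close>: the Bochner integral of a non-integrable function is 0.\<close>

definition Lp_norm :: "real \<Rightarrow> 'a measure \<Rightarrow> ('a \<Rightarrow> real) \<Rightarrow> real" where
  "Lp_norm p \<mu> f = (\<integral>\<omega>. \<bar>f \<omega>\<bar> powr p \<partial>\<mu>) powr (1 / p)"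

text \<open>
  A maximum of finitely many elements of \<^const>\<open>Lp_space\<close> lies in \<^const>\<open>Lp_space\<close> again, so for such
  families with \<open>n \<ge> 1\<close> the norm below is the genuine one. For \<open>n = 0\<close> the value of \<^const>\<open>Max\<close> is
  unspecified.
\<close>

definition incompressible ::
    "real \<Rightarrow> 'a measure \<Rightarrow> real \<Rightarrow> nat \<Rightarrow> (nat \<Rightarrow> 'a \<Rightarrow> real) \<Rightarrow> bool" where
  "incompressible p \<mu> K n x \<longleftrightarrow> Lp_norm p \<mu> (\<lambda>\<omega>. Max ((\<lambda>i. \<bar>x i \<omega>\<bar>) ` {1..n})) \<le> K"

text \<open>
  \<open>\<real>\<^sup>d\<close> with a dimension \<open>d\<close> that is a term: sequences with coordinates \<open>1, \<dots>, d\<close>, extended by 0.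
  In particular \<open>Rvec 0\<close> contains only the zero sequence.
\<close>

definition Rvec :: "nat \<Rightarrow> (nat \<Rightarrow> real) set" where
  "Rvec d = {a. \<forall>k. k \<notin> {1..d} \<longrightarrow> a k = 0}"

definition lp_norm :: "real \<Rightarrow> nat \<Rightarrow> (nat \<Rightarrow> real) \<Rightarrow> real" where
  "lp_norm p d a = (\<Sum>k=1..d. \<bar>a k\<bar> powr p) powr (1 / p)"

end

theory Submission
  imports Defs
begin

text \<open>
  The \<open>p\<close>-th power of a distance is the integral of \<open>\<bar>x i - x j\<bar>\<^sup>p\<close>, so averaging this function over
  sample points \<open>\<omega>\<^sub>1, \<dots>, \<omega>\<^sub>d\<close> yields the \<open>p\<close>-th power of a distance in \<open>\<real>\<^sup>d\<close>. The obstacle is that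
  the functions are unbounded, so that averages need not concentrate. Incompressibility removes it:
  let \<open>m\<close> be the pointwise maximum of the \<open>\<bar>x i\<bar>\<close>. Replacing \<open>\<mu>\<close> by the probability measure \<open>\<nu>\<close> with
  density \<open>m\<^sup>p / \<integral>m\<^sup>p\<close> and \<open>x i\<close> by the multiple of \<open>x i / m\<close> that compensates for this density
  preserves all distances, while the new functions are bounded by \<open>\<parallel>m\<parallel> \<le> K\<close>
  (\<open>incompressible_exists_change_of_density\<close>). The functions to be averaged now take values in \<open>[0, b]\<close>
  with \<open>b = (2K)\<^sup>p\<close>.

  For bounded functions, Hoeffding's lemma and a union bound over the \<open>n\<^sup>2\<close> pairs and the two signs of
  the deviation give a sample of size \<open>d\<close> all of whose averages are \<open>\<epsilon>\<close>-accurate, as soon as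
  \<open>b\<^sup>2 ln (2n\<^sup>2) \<le> 2d\<epsilon>\<^sup>2\<close> (\<open>exists_sample_uniform_deviation_le\<close>). Instead of drawing the points
  independently, the proof picks them one after the other, keeping a sum of exponentials
  of the deviations below the bound on its mean (\<open>exists_sample_sum_prod_le\<close>), which avoids product measures.

  The constant \<open>32e\<^sup>2\<close> leaves ample room. What needs care is that \<open>d\<close> is an integer: if some distance
  power exceeds \<open>\<epsilon>\<close>, then \<open>n \<ge> 2\<close> and \<open>\<epsilon> < b\<close>, so the bound on \<open>d\<close> is at least 1 and rounding it down
  loses at most a factor 2; otherwise \<open>d = 0\<close> works.
\<close>

section \<open>Empirical means of bounded functions\<close>

text \<open>
  The method of conditional expectations: a random next point multiplies each product by a factor of
  mean at most \<open>C\<close>, so some point multiplies their sum by at most \<open>C\<close>.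
\<close>
lemma (in prob_space) exists_sample_sum_prod_le:
  fixes G :: "'b \<Rightarrow> 'a \<Rightarrow> real"
  assumes int: "\<And>a. a \<in> A \<Longrightarrow> integrable M (G a)"
    and nonneg: "\<And>a \<omega>. a \<in> A \<Longrightarrow> \<omega> \<in> space M \<Longrightarrow> 0 \<le> G a \<omega>"
    and le: "\<And>a. a \<in> A \<Longrightarrow> expectation (G a) \<le> C"
  shows "\<exists>\<omega> :: nat \<Rightarrow> 'a. (\<forall>k\<in>{1..d}. \<omega> k \<in> space M) \<and>
           (\<Sum>a\<in>A. \<Prod>k=1..d. G a (\<omega> k)) \<le> real (card A) * C ^ d"
proof (induction d)
  case 0
  show ?case by simp
next
  case (Suc d)
  then obtain \<omega> :: "nat \<Rightarrow> 'a" where \<omega>: "\<And>k. k \<in> {1..d} \<Longrightarrow> \<omega> k \<in> space M"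
    and IH: "(\<Sum>a\<in>A. \<Prod>k=1..d. G a (\<omega> k)) \<le> real (card A) * C ^ d"
    by blast
  define w where "w a = (\<Prod>k=1..d. G a (\<omega> k))" for a
  have w: "0 \<le> w a" if "a \<in> A" for a
    unfolding w_def using \<omega> nonneg[OF that] by (intro prod_nonneg) auto
  have "\<exists>\<eta>\<in>space M. (\<Sum>a\<in>A. w a * G a \<eta>) \<le> real (card A) * C ^ Suc d"
  proof (cases "A = {}")
    case True
    then show ?thesis using not_empty by auto
  next
    case False
    then obtain a0 where "a0 \<in> A" by auto
    have "0 \<le> expectation (G a0)"
      using nonneg[OF \<open>a0 \<in> A\<close>] by (intro integral_nonneg_AE) auto
    then have "0 \<le> C" using le[OF \<open>a0 \<in> A\<close>] by simp
    have I: "integrable M (\<lambda>\<eta>. \<Sum>a\<in>A. w a * G a \<eta>)"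
      using int by auto
    have "expectation (\<lambda>\<eta>. \<Sum>a\<in>A. w a * G a \<eta>) = (\<Sum>a\<in>A. w a * expectation (G a))"
      using int by (subst Bochner_Integration.integral_sum) auto
    also have "\<dots> \<le> (\<Sum>a\<in>A. w a * C)"
      using le w by (intro sum_mono mult_left_mono)
    also have "\<dots> \<le> real (card A) * C ^ Suc d"
      using mult_right_mono[OF IH \<open>0 \<le> C\<close>]
      by (simp add: w_def mult_ac flip: sum_distrib_left)
    finally have E: "expectation (\<lambda>\<eta>. \<Sum>a\<in>A. w a * G a \<eta>) \<le> real (card A) * C ^ Suc d" .
    show ?thesis
    proof (rule ccontr)
      assume "\<not> ?thesis"
      then have "AE \<eta> in M. real (card A) * C ^ Suc d < (\<Sum>a\<in>A. w a * G a \<eta>)"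
        by (intro AE_I2) (auto simp: not_le)
      from expectation_greater[OF I this] E show False by simp
    qed
  qed
  then obtain \<eta> where "\<eta> \<in> space M"
    and \<eta>: "(\<Sum>a\<in>A. w a * G a \<eta>) \<le> real (card A) * C ^ Suc d" by blast
  define \<omega>' where "\<omega>' k = (if k = Suc d then \<eta> else \<omega> k)" for k
  have "\<forall>k\<in>{1..Suc d}. \<omega>' k \<in> space M"
    using \<omega> \<open>\<eta> \<in> space M\<close> by (simp add: \<omega>'_def)
  moreover have "(\<Prod>k=1..Suc d. G a (\<omega>' k)) = w a * G a \<eta>" for a
    by (simp add: w_def \<omega>'_def)
  ultimately show ?case
    using \<eta> by (intro exI[of _ \<omega>']) simp
qed

text \<open>Hoeffding's lemma, in terms of the Bochner integral.\<close>
lemma (in prob_space) expectation_exp_centred_le: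
  fixes f :: "'a \<Rightarrow> real"
  assumes meas: "f \<in> borel_measurable M"
    and bound: "\<And>\<omega>. \<omega> \<in> space M \<Longrightarrow> f \<omega> \<in> {u..v}" and "0 < l"
  shows "integrable M (\<lambda>\<omega>. exp (l * (f \<omega> - expectation f)))"
    and "expectation (\<lambda>\<omega>. exp (l * (f \<omega> - expectation f))) \<le> exp (l\<^sup>2 * (v - u)\<^sup>2 / 8)"
proof -
  interpret interval_bounded_random_variable M f u v
    using meas bound by unfold_locales auto
  note H = Hoeffdings_lemma_nn_integral[OF \<open>0 < l\<close>]
  show I: "integrable M (\<lambda>\<omega>. exp (l * (f \<omega> - expectation f)))"
  proof (rule integrableI_bounded)
    show "(\<integral>\<^sup>+ \<omega>. ennreal (norm (exp (l * (f \<omega> - expectation f)))) \<partial>M) < \<infinity>"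
      using le_less_trans[OF H ennreal_less_top] by simp
  qed (use meas in measurable)
  show "expectation (\<lambda>\<omega>. exp (l * (f \<omega> - expectation f))) \<le> exp (l\<^sup>2 * (v - u)\<^sup>2 / 8)"
    using H by (subst (asm) nn_integral_eq_integral[OF I]) auto
qed

text \<open>
  Hoeffding's inequality with a union bound over \<open>A\<close>. The weak inequality in the condition on \<open>d\<close>
  suffices because the sum of the exponentials dominates each of its terms, without any need for a
  failure probability strictly below 1.
\<close>
lemma (in prob_space) exists_sample_uniform_deviation_le:
  fixes f :: "'b \<Rightarrow> 'a \<Rightarrow> real" and d :: nat
  assumes "finite A" and meas: "\<And>a. a \<in> A \<Longrightarrow> f a \<in> borel_measurable M"
    and bound: "\<And>a \<omega>. a \<in> A \<Longrightarrow> \<omega> \<in> space M \<Longrightarrow> f a \<omega> \<in> {u..v}"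
    and "u < v" and "0 < \<epsilon>"
    and d: "(v - u)\<^sup>2 * ln (2 * real (card A)) \<le> 2 * real d * \<epsilon>\<^sup>2"
  shows "\<exists>\<omega> :: nat \<Rightarrow> 'a. (\<forall>k\<in>{1..d}. \<omega> k \<in> space M) \<and>
           (\<forall>a\<in>A. \<bar>(\<Sum>k=1..d. f a (\<omega> k)) - real d * expectation (f a)\<bar> \<le> real d * \<epsilon>)"
proof -
  define c where "c = (v - u)\<^sup>2"
  \<comment> \<open>This \<open>l\<close> minimises Hoeffding's exponent \<open>l\<^sup>2 c / 8 - l \<epsilon>\<close>; the minimum is \<open>- 2 \<epsilon>\<^sup>2 / c\<close>.\<close>
  define l where "l = 4 * \<epsilon> / c"
  have "0 < c" and "0 < l" using \<open>u < v\<close> \<open>0 < \<epsilon>\<close> by (auto simp: c_def l_def)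
  \<comment> \<open>Adding the functions \<open>- f a\<close> to the family reduces two-sided to one-sided deviations.\<close>
  define B :: "('b \<times> real) set" where "B = A \<times> {1, -1}"
  define h where "h = (\<lambda>(a, s) \<omega>. s * f a \<omega> :: real)"
  have "finite B" and cardB: "card B = 2 * card A"
    using \<open>finite A\<close> by (auto simp: B_def card_cartesian_product)
  define G where "G q \<omega> = exp (l * (h q \<omega> - expectation (h q)))" for q \<omega>
  have G: "integrable M (G q) \<and> expectation (G q) \<le> exp (l\<^sup>2 * c / 8)" if "q \<in> B" for q
  proof -
    obtain a s where q: "q = (a, s)" "a \<in> A" "s = 1 \<or> s = -1"
      using \<open>q \<in> B\<close> unfolding B_def by blast
    have m: "h q \<in> borel_measurable M" using meas q by (auto simp: h_def)
    from q(3) show ?thesis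
    proof
      assume "s = 1"
      then have b: "h q \<omega> \<in> {u..v}" if "\<omega> \<in> space M" for \<omega>
        using bound[OF q(2) that] by (simp add: h_def q)
      show ?thesis unfolding G_def c_def
        using expectation_exp_centred_le[OF m b \<open>0 < l\<close>] by simp
    next
      assume "s = -1"
      then have b: "h q \<omega> \<in> {-v..-u}" if "\<omega> \<in> space M" for \<omega>
        using bound[OF q(2) that] by (simp add: h_def q)
      show ?thesis unfolding G_def c_def
        using expectation_exp_centred_le[OF m b \<open>0 < l\<close>] by (simp add: power2_commute)
    qed
  qed
  obtain \<omega> :: "nat \<Rightarrow> 'a" where \<omega>: "\<forall>k\<in>{1..d}. \<omega> k \<in> space M"
    and S: "(\<Sum>q\<in>B. \<Prod>k=1..d. G q (\<omega> k)) \<le> real (card B) * exp (l\<^sup>2 * c / 8) ^ d"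
    using exists_sample_sum_prod_le[of B G "exp (l\<^sup>2 * c / 8)" d] G by (auto simp: G_def)
  have dev: "(\<Sum>k=1..d. h q (\<omega> k)) - real d * expectation (h q) \<le> real d * \<epsilon>"
    (is "?D \<le> _") if "q \<in> B" for q
  proof -
    have "0 < card A" using \<open>finite A\<close> that by (auto simp: B_def card_gt_0_iff)
    have "exp (l * ?D) = (\<Prod>k=1..d. G q (\<omega> k))"
      by (simp add: G_def sum_distrib_left sum_subtractf right_diff_distrib flip: exp_sum)
    also have "\<dots> \<le> (\<Sum>q\<in>B. \<Prod>k=1..d. G q (\<omega> k))"
      using \<open>finite B\<close> that by (intro member_le_sum prod_nonneg) (auto simp: G_def)
    also note S
    also have "exp (l\<^sup>2 * c / 8) ^ d = exp (real d * (l\<^sup>2 * c / 8))"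
      by (rule exp_of_nat_mult[symmetric])
    also have "real (card B) * \<dots> = exp (ln (2 * real (card A)) + real d * (l\<^sup>2 * c / 8))"
      using \<open>0 < card A\<close> by (simp add: exp_add cardB)
    finally have "l * ?D \<le> ln (2 * real (card A)) + real d * (l\<^sup>2 * c / 8)"
      by simp
    also have "ln (2 * real (card A)) \<le> 2 * real d * \<epsilon>\<^sup>2 / c"
      using d \<open>0 < c\<close> by (simp add: c_def field_simps)
    also have "2 * real d * \<epsilon>\<^sup>2 / c + real d * (l\<^sup>2 * c / 8) = l * (real d * \<epsilon>)"
      using \<open>0 < c\<close> by (simp add: l_def field_simps power2_eq_square)
    finally show ?thesis using \<open>0 < l\<close> by simp
  qed
  have "\<bar>(\<Sum>k=1..d. f a (\<omega> k)) - real d * expectation (f a)\<bar> \<le> real d * \<epsilon>" if "a \<in> A" for a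
    using dev[of "(a, 1)"] dev[of "(a, -1)"] that
    by (simp add: B_def h_def sum_negf)
  with \<omega> show ?thesis by blast
qed

section \<open>Change of density\<close>

text \<open>
  A measure with density \<open>m\<^sup>p / I\<close>, where \<open>I\<close> is the integral of \<open>m\<^sup>p\<close>, compensates exactly for dividing
  all functions by \<open>m / I\<^bsup>1/p\<^esup>\<close>; taking the pointwise maximum for \<open>m\<close> makes the quotients bounded
  by \<open>I\<^bsup>1/p\<^esup> \<le> K\<close>. On the set where \<open>m\<close> vanishes, so do all \<open>x i\<close>, and nothing is lost. Some distance
  is required to be nonzero so that \<open>I > 0\<close> and the density can be normalised.
\<close>
lemma incompressible_exists_change_of_density:
  fixes x :: "nat \<Rightarrow> 'a \<Rightarrow> real"
  assumes "0 < p" and "1 \<le> n"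
    and x: "\<And>i. i \<in> {1..n} \<Longrightarrow> x i \<in> Lp_space p \<mu>"
    and inc: "incompressible p \<mu> K n x"
    and nz: "\<exists>i\<in>{1..n}. \<exists>j\<in>{1..n}. (\<integral>\<omega>. \<bar>x i \<omega> - x j \<omega>\<bar> powr p \<partial>\<mu>) \<noteq> 0"
  shows "\<exists>(\<nu> :: 'a measure) z. prob_space \<nu> \<and>
           (\<forall>i\<in>{1..n}. z i \<in> borel_measurable \<nu>) \<and>
           (\<forall>i\<in>{1..n}. \<forall>\<omega>\<in>space \<nu>. \<bar>z i \<omega>\<bar> \<le> K) \<and>
           (\<forall>i\<in>{1..n}. \<forall>j\<in>{1..n}.
             (\<integral>\<omega>. \<bar>z i \<omega> - z j \<omega>\<bar> powr p \<partial>\<nu>) = (\<integral>\<omega>. \<bar>x i \<omega> - x j \<omega>\<bar> powr p \<partial>\<mu>))"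
proof -
  define m where "m \<omega> = Max ((\<lambda>i. \<bar>x i \<omega>\<bar>) ` {1..n})" for \<omega>
  have [measurable]: "x i \<in> borel_measurable \<mu>" if "i \<in> {1..n}" for i
    using x[OF that] by (simp add: Lp_space_def)
  have m_meas [measurable]: "m \<in> borel_measurable \<mu>"
    unfolding m_def by (rule borel_measurable_Max) auto
  have m_ge: "\<bar>x i \<omega>\<bar> \<le> m \<omega>" if "i \<in> {1..n}" for i \<omega>
    unfolding m_def using that by (intro Max_ge) auto
  have m_in: "\<exists>i\<in>{1..n}. m \<omega> = \<bar>x i \<omega>\<bar>" for \<omega>
  proof -
    have "m \<omega> \<in> (\<lambda>i. \<bar>x i \<omega>\<bar>) ` {1..n}"
      unfolding m_def using \<open>1 \<le> n\<close> by (intro Max_in) auto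
    then show ?thesis by auto
  qed
  have m_nonneg: "0 \<le> m \<omega>" for \<omega>
    using m_in[of \<omega>] by auto
  have m_int: "integrable \<mu> (\<lambda>\<omega>. m \<omega> powr p)"
  proof (rule Bochner_Integration.integrable_bound)
    show "integrable \<mu> (\<lambda>\<omega>. \<Sum>i=1..n. \<bar>x i \<omega>\<bar> powr p)"
      using x by (auto simp: Lp_space_def)
    show "AE \<omega> in \<mu>. norm (m \<omega> powr p) \<le> norm (\<Sum>i=1..n. \<bar>x i \<omega>\<bar> powr p)"
    proof (rule AE_I2)
      fix \<omega>
      obtain i where "i \<in> {1..n}" "m \<omega> = \<bar>x i \<omega>\<bar>" using m_in by blast
      then have "m \<omega> powr p \<le> (\<Sum>i=1..n. \<bar>x i \<omega>\<bar> powr p)"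
        by (auto intro: member_le_sum)
      then show "norm (m \<omega> powr p) \<le> norm (\<Sum>i=1..n. \<bar>x i \<omega>\<bar> powr p)" by simp
    qed
  qed measurable
  define I where "I = (\<integral>\<omega>. m \<omega> powr p \<partial>\<mu>)"
  have "0 \<le> I" unfolding I_def by (intro integral_nonneg_AE) auto
  have "I powr (1 / p) \<le> K"
    using inc m_nonneg by (simp only: incompressible_def Lp_norm_def I_def abs_of_nonneg flip: m_def)
  have "I \<noteq> 0"
  proof
    assume "I = 0"
    then have m0: "AE \<omega> in \<mu>. m \<omega> = 0"
      using integral_nonneg_eq_0_iff_AE[OF m_int] by (simp add: I_def)
    have "(\<integral>\<omega>. \<bar>x i \<omega> - x j \<omega>\<bar> powr p \<partial>\<mu>) = 0" if "i \<in> {1..n}" "j \<in> {1..n}" for i j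
    proof (rule integral_eq_zero_AE)
      show "AE \<omega> in \<mu>. \<bar>x i \<omega> - x j \<omega>\<bar> powr p = 0"
        using m0
      proof eventually_elim
        case (elim \<omega>)
        then show ?case using m_ge[OF that(1), of \<omega>] m_ge[OF that(2), of \<omega>] by simp
      qed
    qed
    with nz show False by blast
  qed
  with \<open>0 \<le> I\<close> have "0 < I" by simp
  define \<nu> where "\<nu> = density \<mu> (\<lambda>\<omega>. m \<omega> powr p / I)"
  define z where "z i \<omega> = I powr (1 / p) * (x i \<omega> / m \<omega>)" for i \<omega>
  have "prob_space \<nu>"
  proof (rule prob_spaceI)
    have "emeasure \<nu> (space \<nu>) = (\<integral>\<^sup>+ \<omega>. ennreal (m \<omega> powr p / I) \<partial>\<mu>)"
      unfolding \<nu>_def by (subst emeasure_density) (auto intro!: nn_integral_cong)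
    also have "\<dots> = ennreal (\<integral>\<omega>. m \<omega> powr p / I \<partial>\<mu>)"
      using m_int \<open>0 < I\<close> by (intro nn_integral_eq_integral) auto
    also have "(\<integral>\<omega>. m \<omega> powr p / I \<partial>\<mu>) = 1"
      using \<open>0 < I\<close> by (simp add: I_def)
    finally show "emeasure \<nu> (space \<nu>) = 1" by simp
  qed
  moreover have z_meas: "z i \<in> borel_measurable \<mu>" if "i \<in> {1..n}" for i
    unfolding z_def using that by measurable
  then have "\<forall>i\<in>{1..n}. z i \<in> borel_measurable \<nu>"
    by (simp add: \<nu>_def)
  moreover have "\<bar>z i \<omega>\<bar> \<le> K" if "i \<in> {1..n}" for i \<omega>
  proof -
    \<comment> \<open>Where \<open>m\<close> vanishes, the quotient is 0 by the convention on division, so the bound holds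
      everywhere and not only almost everywhere.\<close>
    have "\<bar>x i \<omega> / m \<omega>\<bar> \<le> 1"
      using m_ge[OF that, of \<omega>] by (cases "m \<omega> = 0") (auto simp: abs_divide divide_le_eq)
    then have "\<bar>z i \<omega>\<bar> \<le> I powr (1 / p) * 1"
      unfolding z_def abs_mult by (intro mult_mono) auto
    then show ?thesis using \<open>I powr (1 / p) \<le> K\<close> by simp
  qed
  moreover have "(\<integral>\<omega>. \<bar>z i \<omega> - z j \<omega>\<bar> powr p \<partial>\<nu>) = (\<integral>\<omega>. \<bar>x i \<omega> - x j \<omega>\<bar> powr p \<partial>\<mu>)"
    if ij: "i \<in> {1..n}" "j \<in> {1..n}" for i j
  proof -
    have "(\<integral>\<omega>. \<bar>z i \<omega> - z j \<omega>\<bar> powr p \<partial>\<nu>)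
        = (\<integral>\<omega>. (m \<omega> powr p / I) * \<bar>z i \<omega> - z j \<omega>\<bar> powr p \<partial>\<mu>)"
      unfolding \<nu>_def using z_meas ij \<open>0 < I\<close> by (subst integral_density) auto
    also have "\<dots> = (\<integral>\<omega>. \<bar>x i \<omega> - x j \<omega>\<bar> powr p \<partial>\<mu>)"
    proof (rule Bochner_Integration.integral_cong[OF refl])
      fix \<omega>
      show "(m \<omega> powr p / I) * \<bar>z i \<omega> - z j \<omega>\<bar> powr p = \<bar>x i \<omega> - x j \<omega>\<bar> powr p"
      proof (cases "m \<omega> = 0")
        case True
        then show ?thesis using m_ge[OF ij(1), of \<omega>] m_ge[OF ij(2), of \<omega>] by simp
      next
        case False
        with m_nonneg[of \<omega>] have "0 < m \<omega>" by simp
        have "\<bar>z i \<omega> - z j \<omega>\<bar> = I powr (1 / p) * \<bar>x i \<omega> - x j \<omega>\<bar> / m \<omega>"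
          using \<open>0 < m \<omega>\<close> by (simp add: z_def abs_mult flip: right_diff_distrib diff_divide_distrib)
        then have "\<bar>z i \<omega> - z j \<omega>\<bar> powr p = I * \<bar>x i \<omega> - x j \<omega>\<bar> powr p / m \<omega> powr p"
          using \<open>0 < I\<close> \<open>0 < m \<omega>\<close> \<open>0 < p\<close> by (simp add: powr_mult powr_divide powr_powr)
        then show ?thesis using \<open>0 < I\<close> \<open>0 < m \<omega>\<close> by simp
      qed
    qed
    finally show ?thesis .
  qed
  ultimately show ?thesis by blast
qed

section \<open>Dimension reduction\<close>

lemma Lp_norm_powr: "0 < p \<Longrightarrow> Lp_norm p \<mu> f powr p = (\<integral>\<omega>. \<bar>f \<omega>\<bar> powr p \<partial>\<mu>)"
  unfolding Lp_norm_def by (simp add: powr_powr integral_nonneg_AE)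

lemma lp_norm_powr: "0 < p \<Longrightarrow> lp_norm p d a powr p = (\<Sum>k=1..d. \<bar>a k\<bar> powr p)"
  unfolding lp_norm_def by (simp add: powr_powr sum_nonneg)

theorem theorem2:
  fixes p K \<epsilon> :: real and n :: nat
    and \<mu> :: "'a measure" and x :: "nat \<Rightarrow> 'a \<Rightarrow> real"
  assumes "1 \<le> p" and "1 \<le> n" and "0 < K"
    and "prob_space \<mu>"
    and "\<And>i. i \<in> {1..n} \<Longrightarrow> x i \<in> Lp_space p \<mu>"
    and "incompressible p \<mu> K n x"
    and "0 < \<epsilon>" and "\<epsilon> < 1"
  shows "\<exists>(d::nat) (y :: nat \<Rightarrow> nat \<Rightarrow> real).
    real d \<le> 32 * (exp 1)\<^sup>2 * (2 * K) powr (2 * p) * ln (real n) / \<epsilon>\<^sup>2 \<and>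
    (\<forall>i\<in>{1..n}. y i \<in> Rvec d) \<and>
    (\<forall>i\<in>{1..n}. \<forall>j\<in>{1..n}.
      Lp_norm p \<mu> (\<lambda>\<omega>. x i \<omega> - x j \<omega>) powr p - \<epsilon> \<le> lp_norm p d (\<lambda>k. y i k - y j k) powr p \<and>
      lp_norm p d (\<lambda>k. y i k - y j k) powr p \<le> Lp_norm p \<mu> (\<lambda>\<omega>. x i \<omega> - x j \<omega>) powr p + \<epsilon>)"
proof -
  have "0 < p" using \<open>1 \<le> p\<close> by simp
  define D where "D i j = (\<integral>\<omega>. \<bar>x i \<omega> - x j \<omega>\<bar> powr p \<partial>\<mu>)" for i j
  have D_nonneg: "0 \<le> D i j" for i j
    unfolding D_def by (intro integral_nonneg_AE) auto
  define b where "b = (2 * K) powr p"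
  have "0 < b" using \<open>0 < K\<close> by (simp add: b_def)
  define T where "T = 32 * (exp 1)\<^sup>2 * (2 * K) powr (2 * p) * ln (real n) / \<epsilon>\<^sup>2"
  have T_eq: "T = 32 * (exp 1)\<^sup>2 * b\<^sup>2 * ln (real n) / \<epsilon>\<^sup>2"
    by (simp add: T_def b_def power2_eq_square flip: powr_add)
  have "0 \<le> T" using \<open>1 \<le> n\<close> by (simp add: T_eq)
  have e: "1 \<le> (exp 1 :: real)\<^sup>2" by simp
  have T_ge: "32 * (b\<^sup>2 * ln (real n) / \<epsilon>\<^sup>2) \<le> T"
    using mult_right_mono[OF e, of "32 * (b\<^sup>2 * ln (real n) / \<epsilon>\<^sup>2)"] \<open>1 \<le> n\<close>
    by (simp add: T_eq mult_ac)
  have "\<exists>(d::nat) (y :: nat \<Rightarrow> nat \<Rightarrow> real). real d \<le> T \<and> (\<forall>i\<in>{1..n}. y i \<in> Rvec d) \<and>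
      (\<forall>i\<in>{1..n}. \<forall>j\<in>{1..n}. \<bar>(\<Sum>k=1..d. \<bar>y i k - y j k\<bar> powr p) - D i j\<bar> \<le> \<epsilon>)"
  proof (cases "\<forall>i\<in>{1..n}. \<forall>j\<in>{1..n}. D i j \<le> \<epsilon>")
    case True
    then show ?thesis
      using \<open>0 \<le> T\<close> D_nonneg by (intro exI[of _ 0] exI[of _ "\<lambda>_ _. 0"]) (auto simp: Rvec_def)
  next
    case False
    then obtain i0 j0 where i0: "i0 \<in> {1..n}" and j0: "j0 \<in> {1..n}" and D0: "\<epsilon> < D i0 j0"
      by (auto simp: not_le)
    have "i0 \<noteq> j0" using D0 \<open>0 < \<epsilon>\<close> by (auto simp: D_def)
    with i0 j0 have "2 \<le> n" by auto
    have "\<exists>i\<in>{1..n}. \<exists>j\<in>{1..n}. (\<integral>\<omega>. \<bar>x i \<omega> - x j \<omega>\<bar> powr p \<partial>\<mu>) \<noteq> 0"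
      using i0 j0 D0 \<open>0 < \<epsilon>\<close> unfolding D_def by (intro bexI[of _ i0] bexI[of _ j0]) auto
    from incompressible_exists_change_of_density[OF \<open>0 < p\<close> assms(2,5,6) this]
    obtain \<nu> :: "'a measure" and z where "prob_space \<nu>"
      and z_meas: "\<And>i. i \<in> {1..n} \<Longrightarrow> z i \<in> borel_measurable \<nu>"
      and z_le: "\<And>i \<omega>. i \<in> {1..n} \<Longrightarrow> \<omega> \<in> space \<nu> \<Longrightarrow> \<bar>z i \<omega>\<bar> \<le> K"
      and z_D: "\<And>i j. i \<in> {1..n} \<Longrightarrow> j \<in> {1..n} \<Longrightarrow> (\<integral>\<omega>. \<bar>z i \<omega> - z j \<omega>\<bar> powr p \<partial>\<nu>) = D i j"
      unfolding D_def by blast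
    interpret \<nu>: prob_space \<nu> by fact
    define f where "f = (\<lambda>(i, j) \<omega>. \<bar>z i \<omega> - z j \<omega>\<bar> powr p)"
    have f_meas: "f q \<in> borel_measurable \<nu>" if "q \<in> {1..n} \<times> {1..n}" for q
      using that z_meas by (auto simp: f_def)
    have f_bound: "f q \<omega> \<in> {0..b}" if q: "q \<in> {1..n} \<times> {1..n}" and \<omega>: "\<omega> \<in> space \<nu>" for q \<omega>
    proof -
      obtain i j where ij: "q = (i, j)" "i \<in> {1..n}" "j \<in> {1..n}" using q by auto
      have "\<bar>z i \<omega> - z j \<omega>\<bar> \<le> 2 * K"
        using z_le[OF ij(2) \<omega>] z_le[OF ij(3) \<omega>] by linarith
      then show ?thesis
        using \<open>0 < p\<close> by (auto simp: f_def ij b_def intro: powr_mono2)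
    qed
    have "D i0 j0 \<le> b"
    proof -
      have q0: "(i0, j0) \<in> {1..n} \<times> {1..n}" using i0 j0 by blast
      have "integrable \<nu> (f (i0, j0))"
        using f_bound[OF q0] f_meas[OF q0] by (intro \<nu>.integrable_const_bound[of _ b]) auto
      then have "(\<integral>\<omega>. f (i0, j0) \<omega> \<partial>\<nu>) \<le> b"
        using f_bound[OF q0] by (intro \<nu>.integral_le_const) auto
      then show ?thesis using z_D[OF i0 j0] by (simp add: f_def)
    qed
    with D0 have "\<epsilon> < b" by simp
    have ln2: "2 / 3 \<le> ln (real n)"
      using ln2_ge_two_thirds \<open>2 \<le> n\<close> by (meson ln_mono numeral_le_real_of_nat_iff order_trans zero_less_numeral)
    have "1 \<le> b\<^sup>2 / \<epsilon>\<^sup>2" using \<open>\<epsilon> < b\<close> \<open>0 < \<epsilon>\<close> by simp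
    with ln2 have "1 * (2 / 3) \<le> b\<^sup>2 / \<epsilon>\<^sup>2 * ln (real n)" by (intro mult_mono) auto
    with T_ge have "1 \<le> T" by simp
    define d where "d = nat \<lfloor>T\<rfloor>"
    have "1 \<le> \<lfloor>T\<rfloor>" using \<open>1 \<le> T\<close> by simp
    then have "real d = of_int \<lfloor>T\<rfloor>" and "1 \<le> d" unfolding d_def by linarith+
    then have d_le: "real d \<le> T" and T_le: "T \<le> 2 * real d" by linarith+
    \<comment> \<open>As \<open>2 \<le> n\<close>, the factor 2 from the two signs is absorbed in a third factor \<open>n\<close>.\<close>
    have "b\<^sup>2 * ln (2 * real (n * n)) \<le> b\<^sup>2 * (3 * ln (real n))"
    proof (rule mult_left_mono)
      have "ln (2 * real (n * n)) \<le> ln (real n * real (n * n))"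
        using \<open>2 \<le> n\<close> by (intro ln_mono mult_right_mono) auto
      then show "ln (2 * real (n * n)) \<le> 3 * ln (real n)"
        using \<open>2 \<le> n\<close> by (simp add: ln_mult)
    qed simp
    also have "\<dots> \<le> 2 * real d * \<epsilon>\<^sup>2"
    proof -
      have "3 * (b\<^sup>2 * ln (real n) / \<epsilon>\<^sup>2) \<le> 2 * real d"
        using order_trans[OF T_ge T_le] \<open>1 \<le> n\<close> by simp
      then show ?thesis using \<open>0 < \<epsilon>\<close> by (simp add: field_simps)
    qed
    finally have "(b - 0)\<^sup>2 * ln (2 * real (card ({1..n} \<times> {1..n}))) \<le> 2 * real d * \<epsilon>\<^sup>2"
      by simp
    then have "\<exists>w. (\<forall>k\<in>{1..d}. w k \<in> space \<nu>) \<and> (\<forall>q\<in>{1..n} \<times> {1..n}.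
        \<bar>(\<Sum>k=1..d. f q (w k)) - real d * (\<integral>\<omega>. f q \<omega> \<partial>\<nu>)\<bar> \<le> real d * \<epsilon>)"
      using f_meas f_bound \<open>0 < b\<close> \<open>0 < \<epsilon>\<close>
      by (intro \<nu>.exists_sample_uniform_deviation_le[where u = 0 and v = b]) simp_all
    then obtain w :: "nat \<Rightarrow> 'a" where
      w: "\<And>q. q \<in> {1..n} \<times> {1..n} \<Longrightarrow>
            \<bar>(\<Sum>k=1..d. f q (w k)) - real d * (\<integral>\<omega>. f q \<omega> \<partial>\<nu>)\<bar> \<le> real d * \<epsilon>"
      by blast
    define y where "y i k = (if k \<in> {1..d} then z i (w k) / real d powr (1 / p) else 0)" for i k
    have "\<bar>(\<Sum>k=1..d. \<bar>y i k - y j k\<bar> powr p) - D i j\<bar> \<le> \<epsilon>"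
      if ij: "i \<in> {1..n}" "j \<in> {1..n}" for i j
    proof -
      have "\<bar>y i k - y j k\<bar> powr p = f (i, j) (w k) / real d" if "k \<in> {1..d}" for k
        using that \<open>0 < p\<close> \<open>1 \<le> d\<close>
        by (simp add: y_def f_def powr_divide powr_powr abs_divide flip: diff_divide_distrib)
      then have "(\<Sum>k=1..d. \<bar>y i k - y j k\<bar> powr p) - D i j
          = ((\<Sum>k=1..d. f (i, j) (w k)) - real d * D i j) / real d"
        using \<open>1 \<le> d\<close> by (simp add: diff_divide_distrib sum_divide_distrib)
      then show ?thesis
        using w[of "(i, j)"] ij z_D[OF ij] \<open>1 \<le> d\<close>
        by (simp add: f_def abs_divide divide_le_eq mult.commute)
    qed
    moreover have "y i \<in> Rvec d" for i by (simp add: y_def Rvec_def)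
    ultimately show ?thesis using d_le by blast
  qed
  then obtain d :: nat and y :: "nat \<Rightarrow> nat \<Rightarrow> real" where "real d \<le> T"
    and "\<forall>i\<in>{1..n}. y i \<in> Rvec d"
    and close: "\<And>i j. i \<in> {1..n} \<Longrightarrow> j \<in> {1..n} \<Longrightarrow>
          \<bar>(\<Sum>k=1..d. \<bar>y i k - y j k\<bar> powr p) - D i j\<bar> \<le> \<epsilon>"
    by blast
  show ?thesis
  proof (intro exI[of _ d] exI[of _ y] conjI ballI)
    show "real d \<le> 32 * (exp 1)\<^sup>2 * (2 * K) powr (2 * p) * ln (real n) / \<epsilon>\<^sup>2"
      using \<open>real d \<le> T\<close> by (simp add: T_def)
    fix i j assume ij: "i \<in> {1..n}" "j \<in> {1..n}"
    note close [OF ij]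
    then show "Lp_norm p \<mu> (\<lambda>\<omega>. x i \<omega> - x j \<omega>) powr p - \<epsilon> \<le> lp_norm p d (\<lambda>k. y i k - y j k) powr p"
      and "lp_norm p d (\<lambda>k. y i k - y j k) powr p \<le> Lp_norm p \<mu> (\<lambda>\<omega>. x i \<omega> - x j \<omega>) powr p + \<epsilon>"
      unfolding Lp_norm_powr[OF \<open>0 < p\<close>] lp_norm_powr[OF \<open>0 < p\<close>] D_def by linarith+
  qed (use \<open>\<forall>i\<in>{1..n}. y i \<in> Rvec d\<close> in blast)
qed

end
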